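(* Let $T_1:\mathcal{M}\to\mathcal{M}$ and $T_2:\mathcal{N}\to\mathcal{N}$ be two dynamical systems that are topologically conjugate with homeomorphism $h:\mathcal{N}\to\mathcal{M}$, i.e. $T_1=h\circ T_2\circ h^{-1}$. Then the Koopman modes of the two systems are the same. That is, let $f:\mathcal{M}\to\mathbb{C}^m$ be a vector-valued observable, and let $(\phi_j)_{j\ge1}$ be eigenfunctions of the Koopman operator of $T_1$ with eigenvalues $(\lambda_j)_{j\ge1}$. Then vectors $(\vartheta_j)_{j\ge1}$ in $\mathbb{C}^m$ are Koopman modes of $T_1$ for the observable $f$ with respect to the eigenpairs $(\lambda_j,\phi_j)$ if and only if they are Koopman modes of $T_2$ for the observable $f\circ h$ with respect to the eigenpairs $(\lambda_j,\phi_j\circ h)$.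
   Context: $\mathcal{M}$ and $\mathcal{N}$ are the state spaces (topological spaces) of the two discrete-time systems $x_{t+1}=T_1(x_t)$ and $y_{t+1}=T_2(y_t)$. For a system $S:X\to X$, the Koopman operator acts on scalar observables $\psi:X\to\mathbb{C}$ by $[\mathbb{U}\psi](x)=\psi(S(x))$, and an eigenfunction with eigenvalue $\lambda\in\mathbb{C}$ is a nonzero observable $\phi$ with $\mathbb{U}\phi=\lambda\phi$. The observables for $T_2$ corresponding to observables $\psi$ for $T_1$ are $\psi\circ h$; in particular $\phi_j\circ h$ are the eigenfunctions of the Koopman operator of $T_2$ (with eigenvalues $\lambda_j$) corresponding to $\phi_j$. Given a vector-valued observable $g:X\to\mathbb{C}^m$ and eigenpairs $(\lambda_j,\phi_j)_{j\ge1}$ of the Koopman operator of $S$, vectors $\vartheta_j\in\mathbb{C}^m$ are Koopman modes of $S$ for $g$ with respect to these eigenpairs if the Koopman mode decomposition $$g(x_t)=\sum_{j=1}^{\infty}\lambda_j^{\,t}\,\phi_j(x_0)\,\vartheta_j$$ holds for every $x_0\in X$ and every $t\in\{0,1,2,\dots\}$, where $x_t=S^t(x_0)$ (pointwise convergence of the series). *)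

theory Defs
  imports "HOL-Analysis.Analysis"
begin

text \<open>State spaces are abstract topologies, so maps and observables are total functions of which
  only the values on the carrier set matter.\<close>

definition topologically_conjugate_via ::
    "'a topology \<Rightarrow> ('a \<Rightarrow> 'a) \<Rightarrow> 'b topology \<Rightarrow> ('b \<Rightarrow> 'b) \<Rightarrow> ('b \<Rightarrow> 'a) \<Rightarrow> bool" where
  "topologically_conjugate_via M T1 N T2 h \<longleftrightarrow>
     homeomorphic_map N M h \<and>
     (\<forall>x\<in>topspace M. T1 x = h (T2 (inv_into (topspace N) h x)))"

definition koopman :: "('a \<Rightarrow> 'a) \<Rightarrow> ('a \<Rightarrow> complex) \<Rightarrow> 'a \<Rightarrow> complex" where
  "koopman S \<psi> = (\<lambda>x. \<psi> (S x))"

definition koopman_eigenfunction ::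
    "'a set \<Rightarrow> ('a \<Rightarrow> 'a) \<Rightarrow> complex \<Rightarrow> ('a \<Rightarrow> complex) \<Rightarrow> bool" where
  "koopman_eigenfunction X S l \<phi> \<longleftrightarrow>
     (\<exists>x\<in>X. \<phi> x \<noteq> 0) \<and> (\<forall>x\<in>X. koopman S \<phi> x = l * \<phi> x)"

text \<open>Sequences of eigenpairs and modes are indexed from 0 instead of 1. Here \<open>sums\<close> is
  convergence of the partial sums in that order, for each initial state and each time separately;
  in particular \<open>0 ^ 0 = 1\<close> for an eigenvalue 0 at time 0.\<close>

definition koopman_modes ::
    "'a set \<Rightarrow> ('a \<Rightarrow> 'a) \<Rightarrow> ('a \<Rightarrow> complex ^ 'm) \<Rightarrow> (nat \<Rightarrow> complex) \<Rightarrow> (nat \<Rightarrow> 'a \<Rightarrow> complex)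
      \<Rightarrow> (nat \<Rightarrow> complex ^ 'm) \<Rightarrow> bool" where
  "koopman_modes X S g l \<phi> \<theta> \<longleftrightarrow>
     (\<forall>j. koopman_eigenfunction X S (l j) (\<phi> j)) \<and>
     (\<forall>x\<in>X. \<forall>t. (\<lambda>j. (l j ^ t * \<phi> j x) *s \<theta> j) sums g ((S ^^ t) x))"

end

theory Submission
  imports Defs
begin

text \<open>
  Conjugacy gives \<open>T1 (h y) = h (T2 y)\<close> on the carrier of \<open>N\<close>, so \<open>h\<close> carries the orbit of \<open>y\<close>
  under \<open>T2\<close> to the orbit of \<open>h y\<close> under \<open>T1\<close>. The eigenvalue equation and the mode decomposition
  for the pulled-back data at \<open>y\<close> are therefore literally the ones for the original data at \<open>h y\<close>:
  the series agree term by term and so do the candidate limits, which makes convergence no issue.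
  As \<open>h\<close> is onto the carrier of \<open>M\<close>, quantifying over \<open>y\<close> is quantifying over \<open>h y\<close>, and both
  properties transfer in both directions. The lemmas below are stated for such an intertwining
  surjection between invariant sets.
\<close>

lemma topologically_conjugate_via_image:
  assumes "topologically_conjugate_via M T1 N T2 h"
  shows "h ` topspace N = topspace M"
  using assms
  by (simp add: topologically_conjugate_via_def homeomorphic_imp_surjective_map)

lemma topologically_conjugate_via_intertwines:
  assumes "topologically_conjugate_via M T1 N T2 h" and "y \<in> topspace N"
  shows "T1 (h y) = h (T2 y)"
proof -
  have hom: "homeomorphic_map N M h"
    and conj: "\<forall>x\<in>topspace M. T1 x = h (T2 (inv_into (topspace N) h x))"
    using assms(1) by (auto simp: topologically_conjugate_via_def)
  have "h y \<in> topspace M"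
    using topologically_conjugate_via_image[OF assms(1)] assms(2) by blast
  moreover have "inv_into (topspace N) h (h y) = y"
    using homeomorphic_imp_injective_map[OF hom] assms(2) by (rule inv_into_f_f)
  ultimately show ?thesis
    using conj by simp
qed

text \<open>Invariance of \<open>Y\<close> keeps the orbit of \<open>y\<close> where the intertwining relation is available.\<close>

lemma funpow_intertwines_on:
  assumes "S \<in> Y \<rightarrow> Y" and "\<And>y. y \<in> Y \<Longrightarrow> T (h y) = h (S y)" and "y \<in> Y"
  shows "(T ^^ t) (h y) = h ((S ^^ t) y)"
  using assms(3)
proof (induction t arbitrary: y)
  case (Suc t)
  have "(T ^^ Suc t) (h y) = (T ^^ t) (h (S y))"
    using assms(2)[OF Suc.prems] by (simp add: funpow_swap1)
  also have "\<dots> = h ((S ^^ t) (S y))"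
    using Suc assms(1) by blast
  finally show ?case
    by (simp add: funpow_swap1)
qed simp

text \<open>Surjectivity serves both halves: it transfers the eigenvalue equation back to \<open>X\<close>, and it
  prevents a nonzero eigenfunction from vanishing after composition with \<open>h\<close>.\<close>

lemma koopman_eigenfunction_comp_iff:
  assumes "h ` Y = X" and "\<And>y. y \<in> Y \<Longrightarrow> T (h y) = h (S y)"
  shows "koopman_eigenfunction Y S l (\<phi> \<circ> h) \<longleftrightarrow> koopman_eigenfunction X T l \<phi>"
  using assms(2) by (simp add: koopman_eigenfunction_def koopman_def flip: assms(1))

lemma koopman_modes_comp_iff:
  assumes "S \<in> Y \<rightarrow> Y" and "h ` Y = X" and "\<And>y. y \<in> Y \<Longrightarrow> T (h y) = h (S y)"
  shows "koopman_modes Y S (g \<circ> h) l (\<lambda>j. \<phi> j \<circ> h) \<theta> \<longleftrightarrow> koopman_modes X T g l \<phi> \<theta>"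
proof -
  have "(\<forall>x\<in>X. \<forall>t. (\<lambda>j. (l j ^ t * \<phi> j x) *s \<theta> j) sums g ((T ^^ t) x)) \<longleftrightarrow>
    (\<forall>y\<in>Y. \<forall>t. (\<lambda>j. (l j ^ t * \<phi> j (h y)) *s \<theta> j) sums g (h ((S ^^ t) y)))"
    using funpow_intertwines_on[of S Y T h, OF assms(1,3)] by (simp flip: assms(2))
  then show ?thesis
    using koopman_eigenfunction_comp_iff[of h Y X T S, OF assms(2,3)]
    by (simp add: koopman_modes_def)
qed

theorem proposition15:
  fixes M :: "'a topology" and N :: "'b topology"
    and T1 :: "'a \<Rightarrow> 'a" and T2 :: "'b \<Rightarrow> 'b" and h :: "'b \<Rightarrow> 'a"
    and f :: "'a \<Rightarrow> complex ^ 'm"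
    and l :: "nat \<Rightarrow> complex" and \<phi> :: "nat \<Rightarrow> 'a \<Rightarrow> complex"
    and \<theta> :: "nat \<Rightarrow> complex ^ 'm"
  assumes "T1 \<in> topspace M \<rightarrow> topspace M"
    and "T2 \<in> topspace N \<rightarrow> topspace N"
    and "topologically_conjugate_via M T1 N T2 h"
    and "\<And>j. koopman_eigenfunction (topspace M) T1 (l j) (\<phi> j)"
  shows "(\<forall>j. koopman_eigenfunction (topspace N) T2 (l j) (\<phi> j \<circ> h)) \<and>
    (koopman_modes (topspace M) T1 f l \<phi> \<theta> \<longleftrightarrow>
     koopman_modes (topspace N) T2 (f \<circ> h) l (\<lambda>j. \<phi> j \<circ> h) \<theta>)"
proof -
  note image = topologically_conjugate_via_image[OF assms(3)]
  note intertwines = topologically_conjugate_via_intertwines[OF assms(3)]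
  have "koopman_eigenfunction (topspace N) T2 (l j) (\<phi> j \<circ> h)" for j
    using koopman_eigenfunction_comp_iff[of h _ _ T1 T2, OF image intertwines] assms(4) by blast
  moreover have "koopman_modes (topspace N) T2 (f \<circ> h) l (\<lambda>j. \<phi> j \<circ> h) \<theta> \<longleftrightarrow>
      koopman_modes (topspace M) T1 f l \<phi> \<theta>"
    using assms(2) image intertwines by (rule koopman_modes_comp_iff)
  ultimately show ?thesis
    by blast
qed

end
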